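(* Let $p>3$ be a prime. Suppose that the following statement (Conjecture A for $p$) holds: for every integer $n\geq 1$ and every nonsingular $n\times n$ matrix $M$ over $\mathbb{F}_p$ with row vectors $a_1,\dots,a_n\in G:=\mathbb{F}_p^n$, if $$\prod_{1\leq i\leq n}(1-g^{e_i})\cdot\prod_{1\leq i\leq n}(1-g^{a_i})=0\quad\text{in } \mathbb{F}_p[G],$$ then $$\prod_{1\leq i\leq n}(1-g^{e_i})\cdot\prod_{1\leq i\leq n}(1-g^{a_i})=0\quad\text{in } \mathbb{Z}[G],$$ where $e_1,\dots,e_n$ is the standard basis of $\mathbb{F}_p^n$. Then the Alon-Jaeger-Tarsi conjecture holds over $\mathbb{F}_p$: for every integer $n\geq 1$ and every nonsingular $n\times n$ matrix $M$ over $\mathbb{F}_p$ there is a vector $x\in\mathbb{F}_p^n$ such that both $x$ and $Mx$ have only nonzero entries.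
   Context: For a ring $R$ and the additive group $G=\mathbb{F}_p^n$, the group ring $R[G]$ is the ring of formal expressions $\sum_{v\in G} r_v g^v$ with $r_v\in R$, where $g$ is a formal variable (the group $G$ is written multiplicatively via $v\mapsto g^v$, so $g^v g^w=g^{v+w}$ and $g^0=1$). Addition is coefficientwise, and multiplication is given by $\left(\sum_{v} r_v g^v\right)\left(\sum_{v} r'_v g^v\right)=\sum_{v\in G}\left(\sum_{w\in G} r_w r'_{v-w}\right)g^v$. *)

theory Defs
  imports
    "HOL-Algebra.Ring"
    "Jordan_Normal_Form.Matrix"
    "Berlekamp_Zassenhaus.Finite_Field"
begin

text \<open>
  \<open>group_ring TYPE('r) n\<close> is the group ring \<open>R[G]\<close> of the additive group
  \<open>G = carrier_vec n\<close> over a finite ring, with coefficient ring \<open>R\<close>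
  the type \<open>'r\<close>.  An element is its coefficient function, which has to vanish outside \<open>G\<close>
  because vectors of all dimensions share one type.
\<close>

definition gvar :: "'a vec \<Rightarrow> 'a vec \<Rightarrow> 'r :: comm_ring_1" where
  "gvar v = (\<lambda>w. if w = v then 1 else 0)"

definition group_ring ::
    "'r itself \<Rightarrow> nat \<Rightarrow> ('a :: {comm_ring_1, finite} vec \<Rightarrow> 'r :: comm_ring_1) ring" where
  "group_ring R n = \<lparr>
     carrier = {f. \<forall>v. v \<notin> carrier_vec n \<longrightarrow> f v = 0},
     mult = (\<lambda>f h v. if v \<in> carrier_vec n then \<Sum>w\<in>carrier_vec n. f w * h (v - w) else 0),
     one = gvar (0\<^sub>v n),
     zero = (\<lambda>v. 0),
     add = (\<lambda>f h v. f v + h v)\<rparr>"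

definition prod_one_minus_gvar ::
    "nat \<Rightarrow> (nat \<Rightarrow> 'a :: {comm_ring_1, finite} vec) \<Rightarrow> 'a vec \<Rightarrow> 'r :: comm_ring_1" where
  "prod_one_minus_gvar n b = (let S = group_ring TYPE('r) n in
     \<Otimes>\<^bsub>S\<^esub>i\<in>{0..<n}. \<one>\<^bsub>S\<^esub> \<ominus>\<^bsub>S\<^esub> gvar (b i))"

definition AJT_product ::
    "nat \<Rightarrow> 'a :: {comm_ring_1, finite} mat \<Rightarrow> 'a vec \<Rightarrow> 'r :: comm_ring_1" where
  "AJT_product n M =
     prod_one_minus_gvar n (unit_vec n) \<otimes>\<^bsub>group_ring TYPE('r) n\<^esub> prod_one_minus_gvar n (row M)"

text \<open>
  The finite product above is only meaningful in a commutative ring.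
\<close>

lemma finite_carrier_vec_finite:
  "finite (carrier_vec n :: 'a :: finite vec set)"
proof -
  have "carrier_vec n \<subseteq> vec_of_list ` {xs :: 'a list. set xs \<subseteq> UNIV \<and> length xs = n}"
  proof
    fix v :: "'a vec" assume "v \<in> carrier_vec n"
    then have "v = vec_of_list (list_of_vec v)" "length (list_of_vec v) = n"
      by (auto simp: vec_list)
    then show "v \<in> vec_of_list ` {xs. set xs \<subseteq> UNIV \<and> length xs = n}" by blast
  qed
  moreover have "finite {xs :: 'a list. set xs \<subseteq> UNIV \<and> length xs = n}"
    by (rule finite_lists_length_eq) simp
  ultimately show ?thesis by (meson finite_surj)
qed

lemma group_ring_mult_commute:
  fixes f h :: "'a :: {comm_ring_1, finite} vec \<Rightarrow> 'r :: comm_ring_1"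
  shows "f \<otimes>\<^bsub>group_ring TYPE('r) n\<^esub> h = h \<otimes>\<^bsub>group_ring TYPE('r) n\<^esub> f"
proof -
  have "(\<Sum>w\<in>carrier_vec n. f w * h (v - w)) = (\<Sum>w\<in>carrier_vec n. h w * f (v - w))"
    if v: "v \<in> carrier_vec n" for v
  proof (rule sum.reindex_bij_witness[of _ "\<lambda>w. v - w" "\<lambda>w. v - w"])
    fix w :: "'a vec" assume "w \<in> carrier_vec n"
    then have *: "v - (v - w) = w" using v by (auto intro!: eq_vecI)
    then show "v - (v - w) = w" "v - (v - w) = w" by simp_all
    show "h (v - w) * f (v - (v - w)) = f w * h (v - w)"
      by (simp add: * mult.commute)
  qed (use v in auto)
  then show ?thesis by (auto simp: group_ring_def)
qed

lemma group_ring_mult_assoc: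
  fixes f h k :: "'a :: {comm_ring_1, finite} vec \<Rightarrow> 'r :: comm_ring_1"
  shows "(f \<otimes>\<^bsub>group_ring TYPE('r) n\<^esub> h) \<otimes>\<^bsub>group_ring TYPE('r) n\<^esub> k
    = f \<otimes>\<^bsub>group_ring TYPE('r) n\<^esub> (h \<otimes>\<^bsub>group_ring TYPE('r) n\<^esub> k)"
proof -
  let ?G = "carrier_vec n :: 'a vec set"
  have "(\<Sum>w\<in>?G. (\<Sum>u\<in>?G. f u * h (w - u)) * k (v - w))
      = (\<Sum>u\<in>?G. f u * (\<Sum>w\<in>?G. h w * k (v - u - w)))" if v: "v \<in> ?G" for v
  proof -
    have "(\<Sum>w\<in>?G. (\<Sum>u\<in>?G. f u * h (w - u)) * k (v - w))
        = (\<Sum>u\<in>?G. \<Sum>w\<in>?G. f u * (h (w - u) * k (v - w)))"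
      by (subst sum.swap) (simp add: sum_distrib_right mult.assoc)
    also have "\<dots> = (\<Sum>u\<in>?G. \<Sum>w\<in>?G. f u * (h w * k (v - u - w)))"
    proof (rule sum.cong[OF refl])
      fix u assume u: "u \<in> ?G"
      have *: "v - (w + u) = v - u - w" if "w \<in> ?G" for w
        using u v that by (auto intro!: eq_vecI)
      show "(\<Sum>w\<in>?G. f u * (h (w - u) * k (v - w)))
          = (\<Sum>w\<in>?G. f u * (h w * k (v - u - w)))"
      proof (rule sum.reindex_bij_witness[of _ "\<lambda>w. w + u" "\<lambda>w. w - u"])
        fix w assume w: "w \<in> ?G"
        show "w - u + u = w" using u w by (auto intro!: eq_vecI)
        have "v - u - (w - u) = v - w" using u v w by (auto intro!: eq_vecI)
        then show "f u * (h (w - u) * k (v - u - (w - u))) = f u * (h (w - u) * k (v - w))"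
          by simp
      qed (use u in \<open>auto intro!: eq_vecI\<close>)
    qed
    finally show ?thesis by (simp add: sum_distrib_left)
  qed
  then show ?thesis by (auto simp: group_ring_def fun_eq_iff intro!: sum.cong)
qed

lemma group_ring_gvar_mult:
  fixes a b :: "'a :: {comm_ring_1, finite} vec"
  assumes a: "a \<in> carrier_vec n" and b: "b \<in> carrier_vec n"
  shows "gvar a \<otimes>\<^bsub>group_ring TYPE('r) n\<^esub> gvar b = (gvar (a + b) :: 'a vec \<Rightarrow> 'r :: comm_ring_1)"
proof
  fix v :: "'a vec"
  show "(gvar a \<otimes>\<^bsub>group_ring TYPE('r) n\<^esub> gvar b) v = (gvar (a + b) v :: 'r)"
  proof (cases "v \<in> carrier_vec n")
    case True
    have "v - a = b \<longleftrightarrow> v = a + b"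
    proof
      assume "v - a = b"
      moreover have "a + (v - a) = v" using True a by (auto intro!: eq_vecI)
      ultimately show "v = a + b" by simp
    next
      assume "v = a + b"
      then show "v - a = b" using a b by (auto intro!: eq_vecI)
    qed
    then show ?thesis
      using True a by (simp add: group_ring_def gvar_def finite_carrier_vec_finite
        if_distrib[of "\<lambda>x. x * _"] sum.delta cong: if_cong)
  next
    case False
    then show ?thesis using a b by (auto simp: group_ring_def gvar_def)
  qed
qed

lemma group_ring_mult_one:
  fixes f :: "'a :: {comm_ring_1, finite} vec \<Rightarrow> 'r :: comm_ring_1"
  assumes "f \<in> carrier (group_ring TYPE('r) n)"
  shows "\<one>\<^bsub>group_ring TYPE('r) n\<^esub> \<otimes>\<^bsub>group_ring TYPE('r) n\<^esub> f = f"
proof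
  fix v :: "'a vec"
  show "(\<one>\<^bsub>group_ring TYPE('r) n\<^esub> \<otimes>\<^bsub>group_ring TYPE('r) n\<^esub> f) v = f v"
  proof (cases "v \<in> carrier_vec n")
    case True
    have "v - 0\<^sub>v n = v" using True by (auto intro!: eq_vecI)
    then show ?thesis
      using True by (simp add: group_ring_def gvar_def finite_carrier_vec_finite
        if_distrib[of "\<lambda>x. x * _"] sum.delta cong: if_cong)
  next
    case False
    then show ?thesis using assms by (auto simp: group_ring_def)
  qed
qed

lemma cring_group_ring:
  "cring (group_ring TYPE('r) n :: ('a :: {comm_ring_1, finite} vec \<Rightarrow> 'r :: comm_ring_1) ring)"
proof (rule cringI)
  let ?S = "group_ring TYPE('r) n :: ('a vec \<Rightarrow> 'r) ring"
  show "abelian_group ?S"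
  proof (rule abelian_groupI)
    fix f assume "f \<in> carrier ?S"
    then have "(\<lambda>v. - f v) \<in> carrier ?S" "(\<lambda>v. - f v) \<oplus>\<^bsub>?S\<^esub> f = \<zero>\<^bsub>?S\<^esub>"
      by (auto simp: group_ring_def)
    then show "\<exists>h\<in>carrier ?S. h \<oplus>\<^bsub>?S\<^esub> f = \<zero>\<^bsub>?S\<^esub>" by blast
  qed (auto simp: group_ring_def algebra_simps)
  show "comm_monoid ?S"
  proof (rule comm_monoidI)
    fix f h assume "f \<in> carrier ?S" "h \<in> carrier ?S"
    show "f \<otimes>\<^bsub>?S\<^esub> h \<in> carrier ?S" by (auto simp: group_ring_def)
  next
    show "\<one>\<^bsub>?S\<^esub> \<in> carrier ?S" by (auto simp: group_ring_def gvar_def)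
  qed (auto simp: group_ring_mult_assoc group_ring_mult_one intro: group_ring_mult_commute)
  fix f h k assume "f \<in> carrier ?S" "h \<in> carrier ?S" "k \<in> carrier ?S"
  show "(f \<oplus>\<^bsub>?S\<^esub> h) \<otimes>\<^bsub>?S\<^esub> k = f \<otimes>\<^bsub>?S\<^esub> k \<oplus>\<^bsub>?S\<^esub> h \<otimes>\<^bsub>?S\<^esub> k"
    by (auto simp: group_ring_def sum.distrib distrib_right)
qed

end

theory Submission
  imports Defs "HOL-Library.Poly_Mapping" "HOL-Library.Function_Algebras"
    "Jordan_Normal_Form.Determinant"
begin

text \<open>
  A counterexample to the Alon-Jaeger-Tarsi conjecture is turned into a pair of bases, of a larger
  space, that violates Conjecture A.

  Evaluating the product of a matrix \<open>M\<close> at all characters of \<open>G\<close> shows that it vanishes over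
  \<open>\<int>\<close> exactly when every \<open>x\<close> is orthogonal to one of the \<open>2n\<close> vectors \<open>e\<^sub>i\<close>,
  \<open>a\<^sub>i\<close> (\<open>AJT_product_int_eq_zero_iff\<close>); call this a covering. So a counterexample makes the
  product vanish over \<open>\<int>\<close>, and then over every commutative ring. A change of coordinates carries
  Conjecture A over to arbitrary pairs of bases of a finite-dimensional space
  (\<open>conjecture_A_for_families\<close>): if the product of all \<open>1 - g\<^sup>b\<close> vanishes mod \<open>p\<close>, then
  the two bases together are a covering. It therefore suffices to find two bases whose product
  vanishes mod \<open>p\<close> although they are not a covering.

  What distinguishes characteristic \<open>p\<close> is that a linear functional \<open>\<phi>\<close> gives a derivation
  \<open>g\<^sup>v \<mapsto> \<phi>(v) g\<^sup>v\<close> of the group ring. Suppose that \<open>f \<cdot> \<Prod>\<^sub>s (1 - g\<^bsup>v s\<^esup>) = 0\<close>,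
  where \<open>f\<close> has derivative zero and \<open>\<phi>(v m) \<noteq> 0\<close>. Differentiate and multiply by all the
  factors with \<open>s \<noteq> m\<close>: every term that still contains the complete product dies, and only
  \<open>f \<cdot> \<Prod>\<^sub>s\<^sub>\<noteq>\<^sub>m (1 - g\<^bsup>v s\<^esup>)\<^sup>2 = 0\<close> is left, up to a unit
  (\<open>square_off_vanishing_product\<close>). The vector \<open>v m\<close> has disappeared at the price of
  doubling the others, and doubling does not affect coverings. If \<open>v m\<close> was essential for the
  covering, the new multiset is not a covering any more. An essential vector can be arranged by row
  operations (\<open>exists_essential_row\<close>): there are a counterexample \<open>M\<close>, a row \<open>r\<close> and a
  vector \<open>x\<close> orthogonal to \<open>a\<^sub>r\<close> and to no other of the \<open>2n\<close> vectors.

  The doubled multiset has to be contained in the union of two bases, which fails for the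
  \<open>2n\<close> given vectors themselves. So the space is enlarged. For each of the \<open>2n\<close> base vectors
  \<open>t s\<close> a fresh copy of the configuration is added in its own coordinate block, and the copy of
  \<open>u = a\<^sub>r\<close> in that block is replaced by the link \<open>t s + u\<close>. Since the rest of block
  \<open>s\<close>, multiplied by \<open>1 - g\<^sup>u\<close>, vanishes, each link acts on the product as \<open>1 - g\<^bsup>t s\<^esup>\<close>,
  and the whole product still vanishes. But now the links are independent, and it is exactly possible
  to distribute two copies of each link, together with the rest of the blocks, over two bases of the
  enlarged space, of dimension \<open>n (2n + 1)\<close> (\<open>glued_family_basis\<close>). The two copies of the link
  of \<open>a\<^sub>r\<close>, which are no longer needed for the product to vanish, are perturbed in such a way
  that the functional given by \<open>x\<close> on each block is nonzero on all vectors of both bases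
  (\<open>glued_family_pairing_nonzero\<close>). This contradicts Conjecture A.
\<close>

section \<open>Evaluating the products at characters\<close>

definition group_ring_eval ::
    "nat \<Rightarrow> ('r \<Rightarrow> 's) \<Rightarrow> ('a :: {comm_ring_1, finite} vec \<Rightarrow> 's) \<Rightarrow> ('a vec \<Rightarrow> 'r) \<Rightarrow> 's :: comm_ring_1" where
  "group_ring_eval n h \<chi> f = (\<Sum>v\<in>carrier_vec n. h (f v) * \<chi> v)"

text \<open>
  A character with values in a commutative ring extends to a ring homomorphism of the group ring.
  Leaving the coefficient map \<open>h\<close> and the target arbitrary lets one computation serve for complex
  characters, for reducing an integral identity modulo \<open>p\<close>, and for linear maps between groups.
\<close>

locale group_ring_evaluation = comm_ring_hom h
  for h :: "'r :: comm_ring_1 \<Rightarrow> 's :: comm_ring_1" +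
  fixes n :: nat and \<chi> :: "'a :: {comm_ring_1, finite} vec \<Rightarrow> 's"
  assumes character_zero: "\<chi> (0\<^sub>v n) = 1"
    and character_add: "\<lbrakk>v \<in> carrier_vec n; w \<in> carrier_vec n\<rbrakk> \<Longrightarrow> \<chi> (v + w) = \<chi> v * \<chi> w"
begin

abbreviation S :: "('a vec \<Rightarrow> 'r) ring" where "S \<equiv> group_ring TYPE('r) n"
abbreviation ev :: "('a vec \<Rightarrow> 'r) \<Rightarrow> 's" where "ev \<equiv> group_ring_eval n h \<chi>"

lemma eval_gvar:
  assumes "a \<in> carrier_vec n"
  shows "ev (gvar a) = \<chi> a"
proof -
  have "ev (gvar a) = (\<Sum>v\<in>carrier_vec n. if v = a then \<chi> v else 0)"
    unfolding group_ring_eval_def gvar_def by (rule sum.cong) auto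
  also have "\<dots> = \<chi> a"
    using assms by (subst sum.delta) (auto simp: finite_carrier_vec_finite)
  finally show ?thesis .
qed

lemma eval_add: "ev (f \<oplus>\<^bsub>S\<^esub> k) = ev f + ev k"
  by (simp add: group_ring_eval_def group_ring_def hom_add distrib_right sum.distrib)

lemma eval_mult: "ev (f \<otimes>\<^bsub>S\<^esub> k) = ev f * ev k"
proof -
  let ?G = "carrier_vec n :: 'a vec set"
  have "ev (f \<otimes>\<^bsub>S\<^esub> k) = (\<Sum>v\<in>?G. \<Sum>w\<in>?G. h (f w) * h (k (v - w)) * \<chi> v)"
    unfolding group_ring_eval_def group_ring_def
    by (intro sum.cong refl) (simp add: hom_sum hom_mult sum_distrib_right)
  also have "\<dots> = (\<Sum>w\<in>?G. \<Sum>v\<in>?G. h (f w) * h (k (v - w)) * \<chi> v)"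
    by (rule sum.swap)
  also have "\<dots> = (\<Sum>w\<in>?G. \<Sum>v\<in>?G. (h (f w) * \<chi> w) * (h (k v) * \<chi> v))"
  proof (rule sum.cong[OF refl])
    fix w :: "'a vec" assume w: "w \<in> ?G"
    show "(\<Sum>v\<in>?G. h (f w) * h (k (v - w)) * \<chi> v)
        = (\<Sum>v\<in>?G. (h (f w) * \<chi> w) * (h (k v) * \<chi> v))"
    proof (rule sum.reindex_bij_witness[of _ "\<lambda>v. v + w" "\<lambda>v. v - w"])
      fix v :: "'a vec" assume v: "v \<in> ?G"
      show vw: "v - w + w = v" using v w by (auto intro!: eq_vecI)
      have "\<chi> v = \<chi> (v - w) * \<chi> w"
        using character_add[of "v - w" w] v w vw by auto
      then show "(h (f w) * \<chi> w) * (h (k (v - w)) * \<chi> (v - w)) = h (f w) * h (k (v - w)) * \<chi> v"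
        by (simp add: mult_ac)
    qed (use w in \<open>auto intro!: eq_vecI\<close>)
  qed
  also have "\<dots> = ev f * ev k"
    by (simp add: group_ring_eval_def sum_product)
  finally show ?thesis .
qed

lemma gvar_carrier: "a \<in> carrier_vec n \<Longrightarrow> gvar a \<in> carrier S"
  by (auto simp: group_ring_def gvar_def)

lemma eval_one: "ev \<one>\<^bsub>S\<^esub> = 1"
  using eval_gvar[of "0\<^sub>v n"] by (simp add: group_ring_def character_zero)

lemma eval_one_minus_gvar:
  assumes a: "a \<in> carrier_vec n"
  shows "ev (\<one>\<^bsub>S\<^esub> \<ominus>\<^bsub>S\<^esub> gvar a) = 1 - \<chi> a"
proof -
  interpret S: cring S by (rule cring_group_ring)
  have "\<one>\<^bsub>S\<^esub> \<ominus>\<^bsub>S\<^esub> gvar a \<oplus>\<^bsub>S\<^esub> gvar a = \<one>\<^bsub>S\<^esub>"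
    using gvar_carrier[OF a] by (simp add: S.minus_eq S.a_assoc S.l_neg)
  then have "ev (\<one>\<^bsub>S\<^esub> \<ominus>\<^bsub>S\<^esub> gvar a) + ev (gvar a) = ev \<one>\<^bsub>S\<^esub>"
    using eval_add[of "\<one>\<^bsub>S\<^esub> \<ominus>\<^bsub>S\<^esub> gvar a" "gvar a"] by simp
  then show ?thesis by (simp add: eval_one eval_gvar[OF a] algebra_simps)
qed

lemma eval_prod_one_minus_gvar:
  assumes b: "\<And>i. i < n \<Longrightarrow> b i \<in> carrier_vec n"
  shows "ev (prod_one_minus_gvar n b) = (\<Prod>i<n. 1 - \<chi> (b i))"
proof -
  interpret S: cring S by (rule cring_group_ring)
  have "ev (\<Otimes>\<^bsub>S\<^esub>i\<in>I. \<one>\<^bsub>S\<^esub> \<ominus>\<^bsub>S\<^esub> gvar (b i)) = (\<Prod>i\<in>I. 1 - \<chi> (b i))"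
    if "finite I" "I \<subseteq> {0..<n}" for I
    using that
  proof (induction I)
    case empty
    then show ?case by (simp add: eval_one)
  next
    case (insert i I)
    have "gvar (b j) \<in> carrier S" if "j \<in> insert i I" for j
      using insert.prems that by (intro gvar_carrier b) auto
    then show ?case
      using insert b[of i] by (simp add: S.finprod_insert eval_mult eval_one_minus_gvar)
  qed
  from this[of "{0..<n}"] show ?thesis
    by (simp add: prod_one_minus_gvar_def Let_def atLeast0LessThan)
qed

lemma eval_AJT_product:
  assumes "M \<in> carrier_mat n n"
  shows "ev (AJT_product n M) = (\<Prod>i<n. 1 - \<chi> (unit_vec n i)) * (\<Prod>i<n. 1 - \<chi> (row M i))"
  using assms by (simp add: AJT_product_def eval_mult eval_prod_one_minus_gvar)

end

lemma AJT_product_carrier: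
  "(AJT_product n M :: _ \<Rightarrow> 'r :: comm_ring_1) \<in> carrier (group_ring TYPE('r) n)"
  by (auto simp: AJT_product_def group_ring_def)

section \<open>Vanishing over the integers means covering all vectors\<close>

definition root_char :: "'p :: prime_card mod_ring \<Rightarrow> complex" where
  "root_char a = cis (2 * pi * of_int (to_int_mod_ring a) / CARD('p))"

lemma root_char_zero [simp]: "root_char 0 = 1"
  by (simp add: root_char_def)

lemma root_char_add: "root_char (a + b) = root_char a * root_char (b :: 'p :: prime_card mod_ring)"
proof -
  let ?p = "int CARD('p)" and ?s = "to_int_mod_ring a + to_int_mod_ring b"
  have p: "real CARD('p) > 0" by simp
  have "?s = ?p * (?s div ?p) + to_int_mod_ring (a + b)"
    by (simp add: to_int_mod_ring_add)
  then have "of_int ?s = real CARD('p) * of_int (?s div ?p) + of_int (to_int_mod_ring (a + b))"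
    by (metis of_int_add of_int_mult of_int_of_nat_eq)
  then have "2 * pi * of_int ?s / CARD('p)
      = 2 * pi * of_int (?s div ?p) + 2 * pi * of_int (to_int_mod_ring (a + b)) / CARD('p)"
    using p by (simp add: field_simps)
  moreover have "root_char a * root_char b = cis (2 * pi * of_int ?s / CARD('p))"
    by (simp add: root_char_def cis_mult add_divide_distrib distrib_left)
  ultimately have "root_char a * root_char b
      = cis (2 * pi * of_int (?s div ?p)) * root_char (a + b)"
    unfolding root_char_def cis_mult by (simp only:)
  then show ?thesis by (simp add: cis_multiple_2pi)
qed

lemma root_char_eq_1_iff: "root_char (a :: 'p :: prime_card mod_ring) = 1 \<longleftrightarrow> a = 0"
proof
  assume "root_char a = 1"
  then have "cos (2 * pi * of_int (to_int_mod_ring a) / CARD('p)) = 1"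
    by (simp add: root_char_def complex_eq_iff)
  then obtain k :: int where "2 * pi * of_int (to_int_mod_ring a) / CARD('p) = of_int k * 2 * pi"
    by (auto simp: cos_one_2pi_int)
  then have "real_of_int (to_int_mod_ring a) = real_of_int (k * int CARD('p))"
    by (simp add: field_simps)
  then have k: "to_int_mod_ring a = k * int CARD('p)"
    by (simp only: of_int_eq_iff)
  have "to_int_mod_ring a \<in> {0..<int CARD('p)}"
    using range_to_int_mod_ring[where 'a = 'p] by blast
  then have "to_int_mod_ring a mod int CARD('p) = to_int_mod_ring a" by simp
  then have "to_int_mod_ring a = 0" using k by simp
  then show "a = 0" by simp
qed simp

text \<open>
  Translating \<open>x\<close> by a unit vector at a coordinate where \<open>u\<close> is nonzero multiplies the sum by
  a root of unity different from \<open>1\<close>.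
\<close>

lemma sum_characters_eq_0:
  fixes u :: "'p :: prime_card mod_ring vec"
  assumes u: "u \<in> carrier_vec n" and "u \<noteq> 0\<^sub>v n"
  shows "(\<Sum>x\<in>carrier_vec n. root_char (u \<bullet> x)) = 0"
proof -
  let ?G = "carrier_vec n :: 'p mod_ring vec set"
  obtain i where i: "i < n" "u $ i \<noteq> 0"
    using assms by (metis carrier_vecD eq_vecI index_zero_vec(1,2))
  let ?e = "unit_vec n i :: 'p mod_ring vec"
  have "(\<Sum>x\<in>?G. root_char (u \<bullet> x)) = (\<Sum>x\<in>?G. root_char (u \<bullet> (x + ?e)))"
  proof (rule sum.reindex_bij_witness[of _ "\<lambda>x. x + ?e" "\<lambda>x. x - ?e"])
    fix x assume "x \<in> ?G"
    then show e: "x - ?e + ?e = x" by (intro eq_vecI) auto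
    then show "root_char (u \<bullet> (x - ?e + ?e)) = root_char (u \<bullet> x)" by simp
  qed (auto intro!: eq_vecI)
  also have "\<dots> = (\<Sum>x\<in>?G. root_char (u $ i) * root_char (u \<bullet> x))"
    using u i by (intro sum.cong refl) (simp add: scalar_prod_add_distrib[of _ n] root_char_add mult.commute)
  also have "\<dots> = root_char (u $ i) * (\<Sum>x\<in>?G. root_char (u \<bullet> x))"
    by (simp add: sum_distrib_left)
  finally show ?thesis
    using i root_char_eq_1_iff[of "u $ i"] by simp
qed

lemma Fourier_transform_injective:
  fixes f :: "'p :: prime_card mod_ring vec \<Rightarrow> int"
  assumes zero: "\<And>x. x \<in> carrier_vec n \<Longrightarrow> (\<Sum>v\<in>carrier_vec n. of_int (f v) * root_char (v \<bullet> x)) = 0"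
    and w: "w \<in> carrier_vec n"
  shows "f w = 0"
proof -
  let ?G = "carrier_vec n :: 'p mod_ring vec set"
  have fin: "finite ?G" by (rule finite_carrier_vec_finite)
  have "0 = (\<Sum>x\<in>?G. root_char (- w \<bullet> x) * (\<Sum>v\<in>?G. of_int (f v) * root_char (v \<bullet> x)))"
    using zero by simp
  also have "\<dots> = (\<Sum>x\<in>?G. \<Sum>v\<in>?G. of_int (f v) * root_char ((v - w) \<bullet> x))"
    unfolding sum_distrib_left
  proof (intro sum.cong refl)
    fix x v :: "'p mod_ring vec" assume xv: "x \<in> ?G" "v \<in> ?G"
    have "(v - w) \<bullet> x = - w \<bullet> x + v \<bullet> x"
      using xv w by (simp add: minus_scalar_prod_distrib[of _ n])
    then show "root_char (- w \<bullet> x) * (of_int (f v) * root_char (v \<bullet> x))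
        = of_int (f v) * root_char ((v - w) \<bullet> x)"
      by (simp add: root_char_add)
  qed
  also have "\<dots> = (\<Sum>v\<in>?G. of_int (f v) * (\<Sum>x\<in>?G. root_char ((v - w) \<bullet> x)))"
    by (subst sum.swap) (simp add: sum_distrib_left)
  also have "\<dots> = (\<Sum>v\<in>?G. if v = w then of_int (f w) * of_nat (card ?G) else 0)"
  proof (intro sum.cong refl)
    fix v assume v: "v \<in> ?G"
    have "v - w = 0\<^sub>v n \<longleftrightarrow> v = w"
      using v w by (auto simp: vec_eq_iff)
    then show "of_int (f v) * (\<Sum>x\<in>?G. root_char ((v - w) \<bullet> x))
        = (if v = w then of_int (f w) * of_nat (card ?G) else 0 :: complex)"
      using v w sum_characters_eq_0[of "v - w" n] by auto
  qed
  also have "\<dots> = of_int (f w) * of_nat (card ?G)"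
    using w fin by (subst sum.delta) auto
  finally show ?thesis using fin w by (auto simp: card_eq_0_iff)
qed

text \<open>
  At the character of \<open>x\<close> the product takes the value
  \<open>\<Prod>\<^sub>i (1 - \<omega>\<^bsup>x i\<^esup>) \<cdot> \<Prod>\<^sub>i (1 - \<omega>\<^bsup>(M x) i\<^esup>)\<close>, which is zero exactly when some
  exponent is; and an element of the group ring is determined by its values at all characters.
\<close>

lemma AJT_product_int_eq_zero_iff:
  fixes M :: "'p :: prime_card mod_ring mat"
  assumes M: "M \<in> carrier_mat n n"
  shows "AJT_product n M = \<zero>\<^bsub>group_ring TYPE(int) n\<^esub> \<longleftrightarrow>
    (\<forall>x\<in>carrier_vec n. (\<exists>i<n. x $ i = 0) \<or> (\<exists>i<n. (M *\<^sub>v x) $ i = 0))"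
proof -
  let ?f = "AJT_product n M :: 'p mod_ring vec \<Rightarrow> int"
  have ev: "(\<Sum>v\<in>carrier_vec n. of_int (?f v) * root_char (v \<bullet> x)) = 0 \<longleftrightarrow>
      (\<exists>i<n. x $ i = 0) \<or> (\<exists>i<n. (M *\<^sub>v x) $ i = 0)" if x: "x \<in> carrier_vec n" for x
  proof -
    interpret group_ring_evaluation "of_int :: int \<Rightarrow> complex" n "\<lambda>v. root_char (v \<bullet> x)"
      using x by unfold_locales (auto simp: root_char_add add_scalar_prod_distrib[of _ n])
    show ?thesis
      using eval_AJT_product[OF M] x M
      by (auto simp: group_ring_eval_def root_char_eq_1_iff)
  qed
  have "?f = \<zero>\<^bsub>group_ring TYPE(int) n\<^esub> \<longleftrightarrow>
      (\<forall>x\<in>carrier_vec n. (\<Sum>v\<in>carrier_vec n. of_int (?f v) * root_char (v \<bullet> x)) = 0)"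
  proof
    assume *: "\<forall>x\<in>carrier_vec n. (\<Sum>v\<in>carrier_vec n. of_int (?f v) * root_char (v \<bullet> x)) = 0"
    show "?f = \<zero>\<^bsub>group_ring TYPE(int) n\<^esub>"
    proof
      fix w
      show "?f w = \<zero>\<^bsub>group_ring TYPE(int) n\<^esub> w"
        using Fourier_transform_injective[of n ?f w] * AJT_product_carrier[of n M, where 'r = int]
        by (cases "w \<in> carrier_vec n") (auto simp: group_ring_def)
    qed
  qed (simp add: group_ring_def)
  then show ?thesis using ev by simp
qed

section \<open>A counterexample with an essential row\<close>

definition AJT_fails :: "nat \<Rightarrow> 'a :: field mat \<Rightarrow> bool" where
  "AJT_fails n M \<longleftrightarrow>
     (\<forall>x\<in>carrier_vec n. (\<exists>i<n. x $ i = 0) \<or> (\<exists>i<n. (M *\<^sub>v x) $ i = 0))"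

lemma mult_mat_vec_addrow:
  fixes M :: "'a :: field mat"
  assumes "M \<in> carrier_mat n n" "x \<in> carrier_vec n" "k < n" "l < n" "i < n"
  shows "(addrow a k l M *\<^sub>v x) $ i = (if i = k then a * (M *\<^sub>v x) $ l + (M *\<^sub>v x) $ k else (M *\<^sub>v x) $ i)"
proof -
  have "row (addrow a k l M) i = (if i = k then a \<cdot>\<^sub>v row M l + row M k else row M i)"
    using assms by (intro eq_vecI) auto
  then show ?thesis
    using assms by (auto simp: add_scalar_prod_distrib[of _ n])
qed

text \<open>
  Start from a vector without zero entries and let row \<open>i\<close> be orthogonal to it. Adding to row
  \<open>i\<close> a row that is not orthogonal to it keeps the determinant. If the new matrix is no
  counterexample, a vector witnessing this is one for which only row \<open>i\<close> of the old matrix matters.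
  Otherwise the new matrix is a counterexample with fewer rows orthogonal to the start vector, so the
  process stops.
\<close>

lemma exists_essential_row:
  fixes M :: "'a :: field mat"
  assumes "M \<in> carrier_mat n n" "det M \<noteq> 0" "AJT_fails n M"
  shows "\<exists>(M' :: 'a mat) r x. M' \<in> carrier_mat n n \<and> det M' \<noteq> 0 \<and> AJT_fails n M' \<and> r < n \<and>
    x \<in> carrier_vec n \<and> (\<forall>i<n. x $ i \<noteq> 0) \<and> (\<forall>i<n. (M' *\<^sub>v x) $ i = 0 \<longleftrightarrow> i = r)"
proof -
  define z where "z = vec n (\<lambda>i. 1 :: 'a)"
  have z: "z \<in> carrier_vec n" "\<forall>i<n. z $ i \<noteq> 0" by (auto simp: z_def)
  show ?thesis
    using assms
  proof (induction "card {i. i < n \<and> (M *\<^sub>v z) $ i = 0}" arbitrary: M rule: less_induct)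
    case less
    note M = less.prems(1)
    obtain i where i: "i < n" "(M *\<^sub>v z) $ i = 0"
      using less.prems(3) z unfolding AJT_fails_def by blast
    have "z \<noteq> 0\<^sub>v n"
      using i(1) z(2) by auto
    then have "M *\<^sub>v z \<noteq> 0\<^sub>v n"
      using det_0_iff_vec_prod_zero[OF M] less.prems(2) z(1) by blast
    then obtain l where l: "l < n" "(M *\<^sub>v z) $ l \<noteq> 0"
      using M by (metis carrier_matD(1) dim_mult_mat_vec eq_vecI index_zero_vec(1,2))
    let ?N = "addrow 1 i l M"
    have N: "?N \<in> carrier_mat n n" using M by simp
    have "i \<noteq> l" using i l by auto
    then have det: "det ?N \<noteq> 0" using less.prems(2) det_addrow[OF l(1) _ M] by simp
    show ?case
    proof (cases "AJT_fails n ?N")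
      case True
      have N_z: "(?N *\<^sub>v z) $ j = (if j = i then (M *\<^sub>v z) $ l else (M *\<^sub>v z) $ j)" if "j < n" for j
        using mult_mat_vec_addrow[OF M z(1) i(1) l(1) that, of 1] i(2) by simp
      have "{j. j < n \<and> (?N *\<^sub>v z) $ j = 0} = {j. j < n \<and> (M *\<^sub>v z) $ j = 0} - {i}"
      proof (rule Set.set_eqI)
        fix j
        show "j \<in> {j. j < n \<and> (?N *\<^sub>v z) $ j = 0} \<longleftrightarrow> j \<in> {j. j < n \<and> (M *\<^sub>v z) $ j = 0} - {i}"
          using N_z[of j] l(2) by (cases "j = i") (auto simp del: index_mult_mat_vec)
      qed
      then have "{j. j < n \<and> (?N *\<^sub>v z) $ j = 0} \<subset> {j. j < n \<and> (M *\<^sub>v z) $ j = 0}"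
        using i by blast
      then have "card {j. j < n \<and> (?N *\<^sub>v z) $ j = 0} < card {j. j < n \<and> (M *\<^sub>v z) $ j = 0}"
        by (intro psubset_card_mono) auto
      then show ?thesis using less.hyps N det True by blast
    next
      case False
      then obtain x where x: "x \<in> carrier_vec n" "\<forall>j<n. x $ j \<noteq> 0" "\<forall>j<n. (?N *\<^sub>v x) $ j \<noteq> 0"
        unfolding AJT_fails_def by blast
      then have ne: "(M *\<^sub>v x) $ j \<noteq> 0" if "j < n" "j \<noteq> i" for j
        using mult_mat_vec_addrow[OF M x(1) i(1) l(1) that(1), of 1] that by (auto simp del: index_mult_mat_vec)
      have "(M *\<^sub>v x) $ i = 0"
        using less.prems(3) x(1,2) ne unfolding AJT_fails_def by blast
      then have essential: "\<forall>j<n. (M *\<^sub>v x) $ j = 0 \<longleftrightarrow> j = i"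
        using ne by blast
      show ?thesis
      proof (intro exI conjI)
        show "M \<in> carrier_mat n n" "det M \<noteq> 0" "AJT_fails n M" by (fact less.prems)+
        show "i < n" "x \<in> carrier_vec n" "\<forall>j<n. x $ j \<noteq> 0" by (fact i(1) x(1,2))+
        show "\<forall>j<n. (M *\<^sub>v x) $ j = 0 \<longleftrightarrow> j = i" by (fact essential)
      qed
    qed
  qed
qed

section \<open>Derivations of the group ring\<close>

text \<open>
  For vector spaces that vary in the construction, the group ring is the type of finitely supported
  functions with its convolution product, and \<open>gpow v\<close> is \<open>g\<^sup>v\<close>.
\<close>

abbreviation gpow :: "'v :: comm_monoid_add \<Rightarrow> 'v \<Rightarrow>\<^sub>0 'k :: comm_ring_1" where
  "gpow v \<equiv> Poly_Mapping.single v 1"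

text \<open>
  For additive \<open>\<phi>\<close> this satisfies the Leibniz rule. Over the integers the only additive
  \<open>\<phi>\<close> on a finite group is zero, so this is where the characteristic enters.
\<close>

lift_definition derivation :: "('v \<Rightarrow> 'k) \<Rightarrow> ('v \<Rightarrow>\<^sub>0 'k) \<Rightarrow> ('v \<Rightarrow>\<^sub>0 'k :: comm_ring_1)"
  is "\<lambda>\<phi> f v. \<phi> v * f v"
  by (auto elim: rev_finite_subset)

lemma derivation_add: "derivation \<phi> (f + h) = derivation \<phi> f + derivation \<phi> h"
  by (rule poly_mapping_eqI) (simp add: derivation.rep_eq lookup_add algebra_simps)

lemma derivation_zero: "derivation \<phi> 0 = 0"
  by (rule poly_mapping_eqI) (simp add: derivation.rep_eq)

lemma derivation_single: "derivation \<phi> (Poly_Mapping.single v a) = Poly_Mapping.single v (\<phi> v * a)"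
  by (rule poly_mapping_eqI) (simp add: derivation.rep_eq lookup_single when_def)

lemma poly_mapping_additive_induct:
  fixes f :: "'v \<Rightarrow>\<^sub>0 'k :: comm_monoid_add"
  assumes "P 0" and add: "\<And>f h. P f \<Longrightarrow> P h \<Longrightarrow> P (f + h)" and single: "\<And>v a. P (Poly_Mapping.single v a)"
  shows "P f"
proof -
  have f: "f = (\<Sum>v\<in>Poly_Mapping.keys f. Poly_Mapping.single v (Poly_Mapping.lookup f v))"
    by (rule poly_mapping_eqI)
      (auto simp: lookup_sum lookup_single when_def not_in_keys_iff_lookup_eq_zero)
  have "P (\<Sum>v\<in>V. Poly_Mapping.single v (Poly_Mapping.lookup f v))" if "finite V" for V
    using that by (induction V) (auto intro: assms)
  then show ?thesis by (subst f) simp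
qed

lemma derivation_mult:
  fixes f h :: "'v :: comm_monoid_add \<Rightarrow>\<^sub>0 'k :: comm_ring_1"
  assumes \<phi>: "\<And>v w. \<phi> (v + w) = \<phi> v + \<phi> w"
  shows "derivation \<phi> (f * h) = derivation \<phi> f * h + f * derivation \<phi> h"
proof (induction f rule: poly_mapping_additive_induct)
  case (3 v a)
  show ?case
  proof (induction h rule: poly_mapping_additive_induct)
    case (3 w b)
    show ?case
      by (simp add: mult_single derivation_single \<phi> algebra_simps flip: single_add)
  qed (simp_all add: derivation_zero derivation_add algebra_simps)
qed (simp_all add: derivation_zero derivation_add algebra_simps)

lemma derivation_one_minus_gpow:
  fixes v :: "'v :: comm_monoid_add"
  assumes "\<phi> 0 = 0"
  shows "derivation \<phi> (1 - gpow v) = Poly_Mapping.single v (- \<phi> v)"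
  using assms by (intro poly_mapping_eqI)
    (auto simp: derivation.rep_eq lookup_minus lookup_one lookup_single when_def)

lemma derivation_prod_eq_0:
  assumes \<phi>: "\<And>v w. \<phi> (v + w) = \<phi> v + \<phi> w" and "\<phi> 0 = 0"
    and "\<And>i. i \<in> I \<Longrightarrow> derivation \<phi> (f i) = 0"
  shows "derivation \<phi> (\<Prod>i\<in>I. f i) = 0"
proof -
  have "derivation \<phi> 1 = 0"
    using derivation_one_minus_gpow[of \<phi> 0] assms(2) derivation_single[of \<phi> 0 1] by simp
  then show ?thesis
    using assms(3) by (induction I rule: infinite_finite_induct) (auto simp: derivation_mult[OF \<phi>])
qed

text \<open>
  With \<open>Z = 1 - g\<^bsup>v m\<^esup>\<close> and \<open>H\<close> the product of the other factors,
  \<open>D(f Z H) \<cdot> H = D(Z) f H\<^sup>2 + (f Z H) D(H)\<close>. The left side and the last term are zero, and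
  \<open>D(Z)\<close> is a unit.
\<close>

lemma square_off_vanishing_product:
  fixes v :: "'s \<Rightarrow> 'v :: ab_group_add" and f :: "'v \<Rightarrow>\<^sub>0 'k :: field"
  assumes \<phi>: "\<And>v w. \<phi> (v + w) = \<phi> v + \<phi> w"
    and S: "finite S" "m \<in> S" and nz: "\<phi> (v m) \<noteq> 0"
    and f: "derivation \<phi> f = 0"
    and zero: "f * (\<Prod>s\<in>S. 1 - gpow (v s)) = 0"
  shows "f * (\<Prod>s\<in>S - {m}. 1 - gpow (v s))\<^sup>2 = 0"
proof -
  let ?H = "\<Prod>s\<in>S - {m}. 1 - gpow (v s) :: 'v \<Rightarrow>\<^sub>0 'k" and ?Z = "1 - gpow (v m) :: 'v \<Rightarrow>\<^sub>0 'k"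
  have \<phi>0: "\<phi> 0 = 0" by (metis \<phi> add.right_neutral add_cancel_left_right)
  have fZH: "f * (?Z * ?H) = 0" using zero S by (simp add: prod.remove)
  then have "0 = derivation \<phi> (f * (?Z * ?H)) * ?H" by (simp add: derivation_zero)
  also have "\<dots> = derivation \<phi> ?Z * (f * ?H\<^sup>2) + f * (?Z * ?H) * derivation \<phi> ?H"
    unfolding derivation_mult[OF \<phi>] f by (simp add: power2_eq_square distrib_left distrib_right mult_ac)
  also have "\<dots> = Poly_Mapping.single (v m) (- \<phi> (v m)) * (f * ?H\<^sup>2)"
    by (simp only: fZH derivation_one_minus_gpow[of \<phi>, OF \<phi>0]) simp
  finally have "0 = Poly_Mapping.single (- v m) (- inverse (\<phi> (v m)))
      * (Poly_Mapping.single (v m) (- \<phi> (v m)) * (f * ?H\<^sup>2))"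
    by simp
  also have "\<dots> = f * ?H\<^sup>2"
    using nz by (simp add: mult_single flip: mult.assoc)
  finally show ?thesis by simp
qed

section \<open>Conjecture A for arbitrary pairs of bases\<close>

lemma det_nonzero_imp_inverse:
  fixes A :: "'a :: field mat"
  assumes A: "A \<in> carrier_mat n n" "det A \<noteq> 0"
  obtains B where "B \<in> carrier_mat n n" "B * A = 1\<^sub>m n" "A * B = 1\<^sub>m n" "det B \<noteq> 0"
proof -
  obtain B where B: "B \<in> carrier_mat n n" "B * A = 1\<^sub>m n" "A * B = 1\<^sub>m n"
    using det_non_zero_imp_unit[OF A] by (auto simp: Units_def ring_mat_def)
  have "det B * det A = 1" using B A by (metis det_mult det_one)
  then have "det B \<noteq> 0" by auto
  with B that show ?thesis by blast
qed

lemma det_nonzero_iff_invertible_mat: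
  fixes A :: "'a :: field mat"
  assumes A: "A \<in> carrier_mat n n"
  shows "det A \<noteq> 0 \<longleftrightarrow> invertible_mat A"
proof
  assume "det A \<noteq> 0"
  then show "invertible_mat A"
    using A by (elim det_nonzero_imp_inverse[OF A])
      (auto simp: invertible_mat_def inverts_mat_def square_mat.simps)
next
  assume "invertible_mat A"
  then obtain B where "A * B = 1\<^sub>m n" "B * A = 1\<^sub>m (dim_row B)"
    using A by (auto simp: invertible_mat_def inverts_mat_def)
  then have AB: "A * B = 1\<^sub>m n" and "B \<in> carrier_mat n n"
    using A by (metis carrier_matI carrier_matD index_mult_mat(2,3) index_one_mat(2,3))+
  then have "det A * det B = 1" using A by (metis det_mult det_one)
  then show "det A \<noteq> 0" by auto
qed

text \<open>
  The vectors of the family and the coordinates of the space have the same index set \<open>Q\<close>. This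
  makes a linearly independent family a basis without mentioning dimensions.
\<close>

definition basis_family :: "'q set \<Rightarrow> ('q \<Rightarrow> 'q \<Rightarrow> 'a :: comm_ring_1) \<Rightarrow> bool" where
  "basis_family Q b \<longleftrightarrow> (\<forall>q\<in>Q. \<forall>q'. q' \<notin> Q \<longrightarrow> b q q' = 0) \<and>
     (\<forall>y. (\<forall>q'\<in>Q. (\<Sum>q\<in>Q. y q * b q q') = 0) \<longrightarrow> (\<forall>q\<in>Q. y q = 0))"

lemma basis_family_independent:
  assumes "basis_family Q b" "\<And>q'. q' \<in> Q \<Longrightarrow> (\<Sum>q\<in>Q. y q * b q q') = 0" "q \<in> Q"
  shows "y q = 0"
  using assms unfolding basis_family_def by blast

lemma rows_independent:
  fixes M :: "'a :: field mat"
  assumes M: "M \<in> carrier_mat n n" "det M \<noteq> 0"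
    and zero: "\<And>j. j < n \<Longrightarrow> (\<Sum>i<n. c i * M $$ (i, j)) = 0"
    and i: "i < n"
  shows "c i = 0"
proof -
  have "M\<^sup>T *\<^sub>v vec n c = 0\<^sub>v n"
    using M zero by (intro eq_vecI) (auto simp: scalar_prod_def mult.commute atLeast0LessThan)
  moreover have "det (M\<^sup>T) \<noteq> 0" "M\<^sup>T \<in> carrier_mat n n" using M by (auto simp: det_transpose)
  ultimately have "vec n c = 0\<^sub>v n"
    using det_0_iff_vec_prod_zero[of "M\<^sup>T" n] vec_carrier[of n c] by metis
  then show ?thesis using i by (metis index_vec index_zero_vec(1))
qed

lemma basis_family_det_nonzero:
  fixes b :: "'q \<Rightarrow> 'q \<Rightarrow> 'a :: field"
  assumes b: "basis_family Q b" and \<beta>: "bij_betw \<beta> {..<N} Q"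
  shows "det (mat N N (\<lambda>(i, j). b (\<beta> i) (\<beta> j))) \<noteq> 0"
proof
  let ?B = "mat N N (\<lambda>(i, j). b (\<beta> i) (\<beta> j))"
  assume "det ?B = 0"
  then have "det (?B\<^sup>T) = 0" by (subst det_transpose[of _ N]) auto
  then obtain v where v: "v \<in> carrier_vec N" "v \<noteq> 0\<^sub>v N" "?B\<^sup>T *\<^sub>v v = 0\<^sub>v N"
    using det_0_iff_vec_prod_zero[of "?B\<^sup>T" N] by auto
  let ?\<gamma> = "inv_into {..<N} \<beta>"
  have \<gamma>: "?\<gamma> (\<beta> i) = i" if "i < N" for i
    using \<beta> that by (simp add: bij_betw_def)
  have "(\<Sum>q\<in>Q. v $ ?\<gamma> q * b q q') = 0" if q': "q' \<in> Q" for q'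
  proof -
    obtain j where j: "j < N" "q' = \<beta> j" using \<beta> q' unfolding bij_betw_def by blast
    have "(\<Sum>q\<in>Q. v $ ?\<gamma> q * b q q') = (\<Sum>i<N. v $ i * b (\<beta> i) q')"
      by (subst sum.reindex_bij_betw[OF \<beta>, symmetric]) (simp add: \<gamma>)
    also have "\<dots> = (?B\<^sup>T *\<^sub>v v) $ j"
      using v(1) j by (auto simp: scalar_prod_def mult.commute atLeast0LessThan)
    also have "\<dots> = 0" using v(3) j by simp
    finally show ?thesis .
  qed
  then have "\<forall>q\<in>Q. v $ ?\<gamma> q = 0"
    using basis_family_independent[OF b, of "\<lambda>q. v $ ?\<gamma> q"] by blast
  then have "\<forall>i<N. v $ i = 0" using \<gamma> \<beta> by (metis bij_betwE lessThan_iff)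
  then show False using v(1,2) by (auto intro!: eq_vecI)
qed

lemma comm_ring_hom_constant:
  "comm_ring_hom (Poly_Mapping.single 0 :: 'k \<Rightarrow> ('v :: comm_monoid_add \<Rightarrow>\<^sub>0 'k :: comm_ring_1))"
  by unfold_locales (auto simp: single_add mult_single)

text \<open>
  In the coordinates given by the basis \<open>b\<close>, the family \<open>b\<close> becomes the standard basis and
  \<open>c\<close> the rows of \<open>M = C B\<^sup>-\<^sup>1\<close>. The coordinate map is an injective linear map \<open>L\<close>, and
  so is the induced map of group rings; thus the vanishing of the product for \<open>b\<close> and \<open>c\<close>
  implies that for \<open>M\<close>. A functional \<open>X\<close> on the space takes on \<open>b\<close> the entries of
  \<open>B X\<close>, and on \<open>c\<close> those of \<open>M (B X) = C X\<close>.
\<close>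

lemma conjecture_A_for_families:
  fixes b c :: "'q \<Rightarrow> 'q \<Rightarrow> 'p :: prime_card mod_ring"
  assumes conjecture_A:
      "\<forall>n\<ge>1. \<forall>M :: 'p mod_ring mat. M \<in> carrier_mat n n \<and> invertible_mat M \<longrightarrow>
         AJT_product n M = \<zero>\<^bsub>group_ring TYPE('p mod_ring) n\<^esub> \<longrightarrow>
         AJT_product n M = \<zero>\<^bsub>group_ring TYPE(int) n\<^esub>"
    and Q: "finite Q" "Q \<noteq> {}"
    and b: "basis_family Q b" and c: "basis_family Q c"
    and zero: "(\<Prod>q\<in>Q. 1 - gpow (b q)) * (\<Prod>q\<in>Q. 1 - gpow (c q)) = (0 :: _ \<Rightarrow>\<^sub>0 'p mod_ring)"
  shows "\<exists>q\<in>Q. (\<Sum>q'\<in>Q. b q q' * X q') = 0 \<or> (\<Sum>q'\<in>Q. c q q' * X q') = 0"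
proof -
  define N where "N = card Q"
  have N: "N \<ge> 1" using Q by (simp add: N_def Suc_le_eq card_gt_0_iff)
  obtain \<beta> where \<beta>: "bij_betw \<beta> {..<N} Q"
    using ex_bij_betw_nat_finite[OF Q(1)] by (auto simp: N_def atLeast0LessThan)
  have \<beta>Q: "\<beta> i \<in> Q" if "i < N" for i using \<beta> that by (auto simp: bij_betw_def)
  define B where "B = mat N N (\<lambda>(i, j). b (\<beta> i) (\<beta> j))"
  define C where "C = mat N N (\<lambda>(i, j). c (\<beta> i) (\<beta> j))"
  have B: "B \<in> carrier_mat N N" "det B \<noteq> 0" and C: "C \<in> carrier_mat N N" "det C \<noteq> 0"
    using basis_family_det_nonzero[OF b \<beta>] basis_family_det_nonzero[OF c \<beta>]
    by (simp_all add: B_def C_def)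
  obtain B' where B': "B' \<in> carrier_mat N N" "B' * B = 1\<^sub>m N" "det B' \<noteq> 0"
    using det_nonzero_imp_inverse[OF B] by blast
  define M where "M = C * B'"
  have M: "M \<in> carrier_mat N N" using B' C by (simp add: M_def)
  have MB: "M * B = C" using B B' C by (simp add: M_def assoc_mult_mat[of _ N N _ N _ N])
  have "det M \<noteq> 0" using B' C by (simp add: M_def det_mult[of _ N])
  then have inv: "invertible_mat M" using det_nonzero_iff_invertible_mat[OF M] by simp

  define L where "L v = (\<lambda>q'. \<Sum>i<N. v $ i * b (\<beta> i) q')" for v :: "'p mod_ring vec"
  have L_out: "L v q' = 0" if "q' \<notin> Q" for v q'
    using b that \<beta>Q by (auto simp: L_def basis_family_def intro!: sum.neutral)
  have L_unit: "L (unit_vec N i) = b (\<beta> i)" if "i < N" for i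
    using that by (auto simp: L_def fun_eq_iff if_distrib[of "\<lambda>x. x * _"] cong: if_cong)
  have L_row: "L (row M i) = c (\<beta> i)" if i: "i < N" for i
  proof
    fix q'
    show "L (row M i) q' = c (\<beta> i) q'"
    proof (cases "q' \<in> Q")
      case True
      then obtain j where j: "j < N" "q' = \<beta> j" using \<beta> unfolding bij_betw_def by blast
      have "L (row M i) q' = (M * B) $$ (i, j)"
        using i j M by (auto simp: L_def B_def scalar_prod_def atLeast0LessThan)
      then show ?thesis using i j by (simp add: MB C_def)
    next
      case False
      then show ?thesis using L_out c \<beta>Q[OF i] by (auto simp: basis_family_def)
    qed
  qed
  have L_inj: "v = w" if v: "v \<in> carrier_vec N" and w: "w \<in> carrier_vec N" and eq: "L v = L w" for v w
  proof -
    have "v $ i - w $ i = 0" if "i < N" for i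
    proof (rule rows_independent[OF B _ that])
      fix j assume j: "j < N"
      have "(\<Sum>i<N. (v $ i - w $ i) * B $$ (i, j)) = L v (\<beta> j) - L w (\<beta> j)"
        using j by (simp add: L_def B_def left_diff_distrib sum_subtractf)
      then show "(\<Sum>i<N. (v $ i - w $ i) * B $$ (i, j)) = 0" by (simp add: eq)
    qed
    then show ?thesis using v w by (auto intro!: eq_vecI)
  qed

  let ?f = "AJT_product N M :: 'p mod_ring vec \<Rightarrow> 'p mod_ring"
  interpret h: comm_ring_hom "Poly_Mapping.single 0 :: 'p mod_ring \<Rightarrow> (('q \<Rightarrow> 'p mod_ring) \<Rightarrow>\<^sub>0 'p mod_ring)"
    by (rule comm_ring_hom_constant)
  interpret group_ring_evaluation
      "Poly_Mapping.single 0 :: 'p mod_ring \<Rightarrow> (('q \<Rightarrow> 'p mod_ring) \<Rightarrow>\<^sub>0 'p mod_ring)"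
      N "\<lambda>v. gpow (L v)"
  proof unfold_locales
    have "L (0\<^sub>v N) = 0" by (auto simp: L_def fun_eq_iff)
    then show "gpow (L (0\<^sub>v N)) = 1" by simp
    fix v w :: "'p mod_ring vec" assume "v \<in> carrier_vec N" "w \<in> carrier_vec N"
    then have "L (v + w) = L v + L w"
      by (auto simp: L_def fun_eq_iff distrib_right sum.distrib)
    then show "gpow (L (v + w)) = gpow (L v) * gpow (L w)" by (simp add: mult_single)
  qed
  have reindex: "(\<Prod>i<N. 1 - gpow (d (\<beta> i)) :: _ \<Rightarrow>\<^sub>0 'p mod_ring) = (\<Prod>q\<in>Q. 1 - gpow (d q))"
    for d :: "'q \<Rightarrow> 'q \<Rightarrow> 'p mod_ring"
    by (rule prod.reindex_bij_betw[OF \<beta>])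
  have "ev ?f = 0"
    using zero by (simp add: eval_AJT_product[OF M] L_unit L_row reindex)
  then have sum0: "(\<Sum>v\<in>carrier_vec N. Poly_Mapping.single (L v) (?f v)) = 0"
    by (simp add: group_ring_eval_def mult_single)
  have "?f = \<zero>\<^bsub>group_ring TYPE('p mod_ring) N\<^esub>"
  proof
    fix w
    show "?f w = \<zero>\<^bsub>group_ring TYPE('p mod_ring) N\<^esub> w"
    proof (cases "w \<in> carrier_vec N")
      case True
      have "0 = Poly_Mapping.lookup (\<Sum>v\<in>carrier_vec N. Poly_Mapping.single (L v) (?f v)) (L w)"
        by (simp add: sum0)
      also have "\<dots> = (\<Sum>v\<in>carrier_vec N. if v = w then ?f w else 0)"
        unfolding lookup_sum
        by (intro sum.cong refl) (auto simp: lookup_single when_def dest: L_inj[OF _ True])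
      also have "\<dots> = ?f w"
        using True by (subst sum.delta) (auto simp: finite_carrier_vec_finite)
      finally show ?thesis by (simp add: group_ring_def)
    next
      case False
      then show ?thesis using AJT_product_carrier[of N M, where 'r = "'p mod_ring"]
        by (auto simp: group_ring_def)
    qed
  qed
  then have "AJT_product N M = \<zero>\<^bsub>group_ring TYPE(int) N\<^esub>"
    using conjecture_A N M inv by blast
  then have fails: "\<forall>x\<in>carrier_vec N. (\<exists>i<N. x $ i = 0) \<or> (\<exists>i<N. (M *\<^sub>v x) $ i = 0)"
    by (simp only: AJT_product_int_eq_zero_iff[OF M])
  define x where "x = vec N (\<lambda>j. X (\<beta> j))"
  have x: "x \<in> carrier_vec N" by (simp add: x_def)
  have pair: "(mat N N (\<lambda>(i, j). d (\<beta> i) (\<beta> j)) *\<^sub>v x) $ i = (\<Sum>q'\<in>Q. d (\<beta> i) q' * X q')"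
    if "i < N" for d :: "'q \<Rightarrow> 'q \<Rightarrow> 'p mod_ring" and i
    using that
    by (subst sum.reindex_bij_betw[OF \<beta>, symmetric]) (simp add: x_def scalar_prod_def atLeast0LessThan)
  have Bx: "(B *\<^sub>v x) $ i = (\<Sum>q'\<in>Q. b (\<beta> i) q' * X q')" if "i < N" for i
    using pair[OF that] by (simp only: B_def)
  have "M *\<^sub>v (B *\<^sub>v x) = C *\<^sub>v x"
    using assoc_mult_mat_vec[OF M B(1) x] by (simp add: MB)
  then have Cx: "(M *\<^sub>v (B *\<^sub>v x)) $ i = (\<Sum>q'\<in>Q. c (\<beta> i) q' * X q')" if "i < N" for i
    using pair[OF that] by (simp only: C_def)
  have "B *\<^sub>v x \<in> carrier_vec N" using B x by simp
  then consider i where "i < N" "(B *\<^sub>v x) $ i = 0" | i where "i < N" "(M *\<^sub>v (B *\<^sub>v x)) $ i = 0"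
    using fails by blast
  then show ?thesis
  proof cases
    case (1 i)
    then show ?thesis using Bx[of i] \<beta>Q[of i] by metis
  next
    case (2 i)
    then show ?thesis using Cx[of i] \<beta>Q[of i] by metis
  qed
qed

section \<open>Gluing copies of a configuration\<close>

text \<open>
  The enlarged space consists of a base block \<open>None\<close> and one block for each of the \<open>2n\<close>
  vectors of the configuration. The vector with index \<open>(False, k)\<close> is \<open>e\<^sub>k\<close>, and
  the one with index \<open>(True, k)\<close> is \<open>a\<^sub>k\<close>; the Boolean is the colour of the vector and of its
  block. Each block has \<open>n\<close> coordinates.
\<close>

type_synonym block = "(bool \<times> nat) option"

definition blocks :: "nat \<Rightarrow> block set" where
  "blocks n = insert None (Some ` (UNIV \<times> {..<n}))"

definition slots :: "nat \<Rightarrow> (block \<times> nat) set" where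
  "slots n = blocks n \<times> {..<n}"

lemma finite_blocks: "finite (blocks n)"
  by (simp add: blocks_def)

lemma finite_slots: "finite (slots n)"
  by (simp add: slots_def finite_blocks)

lemma (in comm_monoid_set) slots_split:
  "F g (slots n) = f (F (\<lambda>k. g (None, k)) {..<n})
     (f (F (\<lambda>k. F (\<lambda>j. g (Some (\<sigma>, k), j)) {..<n}) {..<n})
        (F (\<lambda>k. F (\<lambda>j. g (Some (\<not> \<sigma>, k), j)) {..<n}) {..<n}))"
proof -
  let ?h = "\<lambda>s. F (\<lambda>j. g (s, j)) {..<n}"
  have "F g (slots n) = F ?h (insert None (Some ` (UNIV \<times> {..<n})))"
    by (simp only: slots_def blocks_def cartesian_product')
  also have "\<dots> = f (?h None) (F ?h (Some ` (UNIV \<times> {..<n})))"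
    by (subst insert) auto
  also have "F ?h (Some ` (UNIV \<times> {..<n})) = F (?h \<circ> Some) (UNIV \<times> {..<n})"
    by (rule reindex) simp
  also have "\<dots> = F (\<lambda>\<tau>. F (\<lambda>k. ?h (Some (\<tau>, k))) {..<n}) UNIV"
    by (simp only: cartesian_product' comp_def)
  also have "\<dots> = f (F (\<lambda>k. ?h (Some (\<sigma>, k))) {..<n}) (F (\<lambda>k. ?h (Some (\<not> \<sigma>, k))) {..<n})"
    by (cases \<sigma>) (simp_all add: UNIV_bool commute)
  finally show ?thesis .
qed

lemma (in comm_monoid_set) signed_index_split:
  "F g (UNIV \<times> {..<n :: nat}) = f (F (\<lambda>k. g (\<sigma>, k)) {..<n}) (F (\<lambda>k. g (\<not> \<sigma>, k)) {..<n})"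
proof -
  have "F g (UNIV \<times> {..<n}) = F (\<lambda>\<tau>. F (\<lambda>k. g (\<tau>, k)) {..<n}) UNIV"
    by (rule cartesian_product')
  then show ?thesis
    by (cases \<sigma>) (simp_all add: UNIV_bool commute)
qed

definition at_block :: "nat \<Rightarrow> 'b \<Rightarrow> 'a :: zero vec \<Rightarrow> 'b \<times> nat \<Rightarrow> 'a" where
  "at_block n s v = (\<lambda>(s', j). if s' = s \<and> j < n then v $ j else 0)"

lemma at_block_apply [simp]: "j < n \<Longrightarrow> at_block n s v (s', j) = (if s' = s then v $ j else 0)"
  by (simp add: at_block_def)

lemma at_block_zero: "at_block n s (0\<^sub>v n) = (0 :: _ \<Rightarrow> 'a :: comm_ring_1)"
  by (auto simp: at_block_def fun_eq_iff)

lemma at_block_add: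
  "v \<in> carrier_vec n \<Longrightarrow> w \<in> carrier_vec n \<Longrightarrow>
    at_block n s (v + w) = at_block n s v + (at_block n s w :: _ \<Rightarrow> 'a :: comm_ring_1)"
  by (auto simp: at_block_def fun_eq_iff)

lemma at_block_pairing:
  fixes v x :: "'a :: comm_ring_1 vec"
  assumes s: "s \<in> blocks n" and x: "x \<in> carrier_vec n"
  shows "(\<Sum>q\<in>slots n. at_block n s v q * x $ snd q) = v \<bullet> x"
proof -
  have "(\<Sum>q\<in>slots n. at_block n s v q * x $ snd q)
      = (\<Sum>s'\<in>blocks n. \<Sum>j<n. at_block n s v (s', j) * x $ j)"
    by (simp only: slots_def sum.cartesian_product' snd_conv)
  also have "\<dots> = (\<Sum>s'\<in>blocks n. if s' = s then \<Sum>j<n. v $ j * x $ j else 0)"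
    by (intro sum.cong refl) auto
  also have "\<dots> = (\<Sum>j<n. v $ j * x $ j)"
    using s by (subst sum.delta) (auto simp: finite_blocks)
  finally show ?thesis using x by (simp add: scalar_prod_def atLeast0LessThan)
qed

definition signed_row :: "nat \<Rightarrow> 'a :: comm_ring_1 mat \<Rightarrow> bool \<times> nat \<Rightarrow> 'a vec" where
  "signed_row n M = (\<lambda>(\<sigma>, k). row (if \<sigma> then M else 1\<^sub>m n) k)"

text \<open>
  This is the basis of colour \<open>\<sigma>\<close>, which is the part of the construction where the counting
  comes out exactly. The base block carries the links of the vectors of colour \<open>\<sigma>\<close>. Their blocks
  are filled with unit vectors. A block of the other colour is filled with the rows of \<open>M\<close>, except
  that its row \<open>r\<close> becomes a second copy of the link of that block. In this way each block
  contributes the unit vectors to one basis and the rows other than \<open>r\<close> to the other, and each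
  link occurs once in either basis. The parameters \<open>u\<close> and \<open>t\<close> leave room for perturbing
  some of the links: \<open>u\<close> in the copies listed in the base block, \<open>t\<close> in the other copies.
\<close>

definition glued_family ::
    "nat \<Rightarrow> 'a :: comm_ring_1 mat \<Rightarrow> nat \<Rightarrow> (bool \<times> nat \<Rightarrow> 'a vec) \<Rightarrow> (bool \<times> nat \<Rightarrow> 'a vec) \<Rightarrow> bool
      \<Rightarrow> block \<times> nat \<Rightarrow> block \<times> nat \<Rightarrow> 'a" where
  "glued_family n M r u t \<sigma> = (\<lambda>(s, j). case s of
     None \<Rightarrow> at_block n None (signed_row n M (\<sigma>, j)) + at_block n (Some (\<sigma>, j)) (u (\<sigma>, j))
   | Some s \<Rightarrow>
       if fst s = \<sigma> then at_block n (Some s) (unit_vec n j)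
       else if j = r then at_block n None (t s) + at_block n (Some s) (row M j)
       else at_block n (Some s) (row M j))"

text \<open>
  The family is triangular. Project a vanishing linear combination to a block of the other colour: only
  rows of \<open>M\<close> are visible there, so their coefficients vanish. What remains in the base block is a
  combination of vectors of colour \<open>\<sigma>\<close>. After that only the unit vectors in the blocks of
  colour \<open>\<sigma>\<close> are left. The vectors \<open>u\<close> and \<open>t\<close> can be arbitrary because each of them
  shows up only after its coefficient is known to vanish.
\<close>

lemma glued_family_basis:
  fixes M :: "'a :: field mat"
  assumes M: "M \<in> carrier_mat n n" "det M \<noteq> 0"
  shows "basis_family (slots n) (glued_family n M r u t \<sigma>)"
proof -
  let ?b = "glued_family n M r u t \<sigma>" and ?A = "if \<sigma> then M else 1\<^sub>m n"
  have A: "?A \<in> carrier_mat n n" "det ?A \<noteq> 0" using M by auto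
  have "?b q q' = 0" if "q \<in> slots n" "q' \<notin> slots n" for q q'
    using that by (cases q; cases q'; force simp: glued_family_def at_block_def slots_def blocks_def split: option.split)
  moreover have "y q = 0"
    if zero: "\<forall>q'\<in>slots n. (\<Sum>q\<in>slots n. y q * ?b q q') = 0" and q: "q \<in> slots n" for y q
  proof -
    have split: "(\<Sum>k<n. y (None, k) * ?b (None, k) q')
        + ((\<Sum>k<n. \<Sum>j<n. y (Some (\<sigma>, k), j) * ?b (Some (\<sigma>, k), j) q')
        + (\<Sum>k<n. \<Sum>j<n. y (Some (\<not> \<sigma>, k), j) * ?b (Some (\<not> \<sigma>, k), j) q')) = 0"
      if "q' \<in> slots n" for q'
      using zero[rule_format, OF that] unfolding sum.slots_split[where \<sigma> = \<sigma>] .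
    have rows: "y (Some (\<not> \<sigma>, k), j) = 0" if k: "k < n" and j: "j < n" for k j
    proof (rule rows_independent[OF M _ j])
      fix i assume i: "i < n"
      have "0 = (\<Sum>k'<n. \<Sum>j<n. y (Some (\<not> \<sigma>, k'), j) * ?b (Some (\<not> \<sigma>, k'), j) (Some (\<not> \<sigma>, k), i))"
        using split[of "(Some (\<not> \<sigma>, k), i)"] k i by (simp add: glued_family_def slots_def blocks_def)
      also have "\<dots> = (\<Sum>k'<n. if k' = k then \<Sum>j<n. y (Some (\<not> \<sigma>, k), j) * M $$ (j, i) else 0)"
        using i M by (intro sum.cong refl) (auto simp: glued_family_def intro!: sum.cong sum.neutral)
      also have "\<dots> = (\<Sum>j<n. y (Some (\<not> \<sigma>, k), j) * M $$ (j, i))"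
        using k by (subst sum.delta) auto
      finally show "(\<Sum>j<n. y (Some (\<not> \<sigma>, k), j) * M $$ (j, i)) = 0" by simp
    qed
    have base: "y (None, k) = 0" if k: "k < n" for k
    proof (rule rows_independent[OF A _ k])
      fix i assume i: "i < n"
      have "0 = (\<Sum>k<n. y (None, k) * ?b (None, k) (None, i))"
        using split[of "(None, i)"] i by (simp add: glued_family_def slots_def blocks_def rows)
      also have "\<dots> = (\<Sum>k<n. y (None, k) * ?A $$ (k, i))"
        using i A by (intro sum.cong refl) (auto simp: glued_family_def signed_row_def)
      finally show "(\<Sum>k<n. y (None, k) * ?A $$ (k, i)) = 0" by simp
    qed
    have units: "y (Some (\<sigma>, k), j) = 0" if k: "k < n" and j: "j < n" for k j
    proof -
      have "0 = (\<Sum>k'<n. \<Sum>i<n. y (Some (\<sigma>, k'), i) * ?b (Some (\<sigma>, k'), i) (Some (\<sigma>, k), j))"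
        using split[of "(Some (\<sigma>, k), j)"] k j by (simp add: slots_def blocks_def rows base)
      also have "\<dots> = (\<Sum>k'<n. if k' = k then \<Sum>i<n. if i = j then y (Some (\<sigma>, k), i) else 0 else 0)"
        using j by (intro sum.cong refl) (auto simp: glued_family_def if_distrib[of "\<lambda>c. a * c" for a] cong: if_cong)
      also have "\<dots> = y (Some (\<sigma>, k), j)" using k j by simp
      finally show ?thesis by simp
    qed
    show "y q = 0"
    proof (cases q)
      case (Pair s j)
      show ?thesis
      proof (cases s)
        case None
        then show ?thesis using Pair q base by (simp add: slots_def blocks_def)
      next
        case (Some s')
        then obtain \<tau> k where "q = (Some (\<tau>, k), j)" "k < n" "j < n"
          using Pair q by (auto simp: slots_def blocks_def)
        then show ?thesis using rows[of k j] units[of k j] by (cases "\<tau> = \<sigma>") auto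
      qed
    qed
  qed
  ultimately show ?thesis unfolding basis_family_def by blast
qed

section \<open>The product of the glued bases vanishes\<close>

text \<open>
  An integral identity between products survives every ring homomorphism; here the integers
  are mapped to the coefficient ring and \<open>G\<close> is embedded as one block of the large space.
\<close>

lemma prod_at_block_eq_0:
  fixes M :: "'a :: {comm_ring_1, finite} mat"
  assumes M: "M \<in> carrier_mat n n"
    and zero: "AJT_product n M = \<zero>\<^bsub>group_ring TYPE(int) n\<^esub>"
  shows "(\<Prod>j<n. 1 - gpow (at_block n s (unit_vec n j))) * (\<Prod>j<n. 1 - gpow (at_block n s (row M j)))
    = (0 :: _ \<Rightarrow>\<^sub>0 'k :: comm_ring_1)"
proof -
  interpret group_ring_evaluation "of_int :: int \<Rightarrow> (_ \<Rightarrow>\<^sub>0 'k)" n "\<lambda>v. gpow (at_block n s v)"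
    by unfold_locales (auto simp: at_block_zero at_block_add mult_single)
  show ?thesis
    using eval_AJT_product[OF M] by (simp add: zero group_ring_eval_def group_ring_def)
qed

lemma absorb_gpow:
  fixes f :: "'v :: comm_monoid_add \<Rightarrow>\<^sub>0 'k :: comm_ring_1"
  assumes "f * (1 - gpow u) = 0"
  shows "f * (1 - gpow (v + u)) = f * (1 - gpow v)"
proof -
  have "f * gpow u = f" using assms by (simp add: algebra_simps)
  then have "f * (gpow v * gpow u) = f * gpow v" by (metis mult.left_commute mult.commute)
  then show ?thesis by (simp add: algebra_simps mult_single)
qed

text \<open>
  Block \<open>s\<close> without its row \<open>r\<close>, whose place is taken by the link.
\<close>

definition block_core :: "nat \<Rightarrow> 'a :: comm_ring_1 mat \<Rightarrow> nat \<Rightarrow> bool \<times> nat \<Rightarrow> (block \<times> nat \<Rightarrow> 'a) \<Rightarrow>\<^sub>0 'a" where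
  "block_core n M r s = (\<Prod>j<n. 1 - gpow (at_block n (Some s) (unit_vec n j)))
     * (\<Prod>j\<in>{..<n} - {r}. 1 - gpow (at_block n (Some s) (row M j)))"

definition link :: "nat \<Rightarrow> 'a :: comm_ring_1 mat \<Rightarrow> nat \<Rightarrow> bool \<times> nat \<Rightarrow> block \<times> nat \<Rightarrow> 'a" where
  "link n M r s = at_block n None (signed_row n M s) + at_block n (Some s) (row M r)"

text \<open>
  The core of block \<open>s\<close> is annihilated by \<open>1 - g\<^sup>u\<close> for the row \<open>u\<close> missing from it,
  so in its presence \<open>g\<^sup>u\<close> acts as \<open>1\<close> and the link can be replaced by the base vector
  alone. This leaves the vanishing product of the base block.
\<close>

lemma block_core_link_product_eq_0:
  fixes M :: "'a :: {field, finite} mat"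
  assumes M: "M \<in> carrier_mat n n" and r: "r < n"
    and zero: "AJT_product n M = \<zero>\<^bsub>group_ring TYPE(int) n\<^esub>"
  shows "(\<Prod>s\<in>UNIV \<times> {..<n}. block_core n M r s) * (\<Prod>s\<in>UNIV \<times> {..<n}. 1 - gpow (link n M r s)) = 0"
proof -
  let ?base = "\<lambda>s. 1 - gpow (at_block n None (signed_row n M s)) :: (block \<times> nat \<Rightarrow> 'a) \<Rightarrow>\<^sub>0 'a"
  have "block_core n M r s * (1 - gpow (at_block n (Some s) (row M r))) = 0" for s
    using prod_at_block_eq_0[OF M zero, of "Some s", where 'k = 'a] r
    by (simp add: block_core_def prod.remove[of "{..<n}" r] mult_ac)
  then have absorb: "block_core n M r s * (1 - gpow (link n M r s)) = block_core n M r s * ?base s" for s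
    unfolding link_def by (rule absorb_gpow)
  have "(\<Prod>s\<in>UNIV \<times> {..<n}. ?base s) = 0"
    using prod_at_block_eq_0[OF M zero, of "None :: block", where 'k = 'a]
    by (simp add: prod.signed_index_split[where \<sigma> = False] signed_row_def)
  then have "(\<Prod>s\<in>UNIV \<times> {..<n}. block_core n M r s * ?base s) = 0"
    by (simp add: prod.distrib)
  then show ?thesis
    by (simp add: prod.distrib flip: absorb)
qed

text \<open>
  The functional reads a coordinate of the base block at which row \<open>r\<close> is nonzero. It is zero on
  the cores, which live in the other blocks, but not on the link of row \<open>r\<close>.
\<close>

lemma block_core_link_square_eq_0:
  fixes M :: "'a :: {field, finite} mat"
  assumes M: "M \<in> carrier_mat n n" "det M \<noteq> 0" and r: "r < n"
    and zero: "AJT_product n M = \<zero>\<^bsub>group_ring TYPE(int) n\<^esub>"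
  shows "(\<Prod>s\<in>UNIV \<times> {..<n}. block_core n M r s)
    * (\<Prod>s\<in>UNIV \<times> {..<n} - {(True, r)}. 1 - gpow (link n M r s))\<^sup>2 = 0"
proof -
  have "\<exists>i<n. M $$ (r, i) \<noteq> 0"
  proof (rule ccontr)
    assume "\<not> (\<exists>i<n. M $$ (r, i) \<noteq> 0)"
    then have "(\<Sum>j<n. (if j = r then 1 else 0) * M $$ (j, i)) = 0" if "i < n" for i
      using that by (intro sum.neutral) auto
    from rows_independent[OF M this r] show False by simp
  qed
  then obtain i where i: "i < n" "M $$ (r, i) \<noteq> 0" by blast
  define \<phi> where "\<phi> v = v (None, i)" for v :: "block \<times> nat \<Rightarrow> 'a"
  have \<phi>_add: "\<phi> (v + w) = \<phi> v + \<phi> w" and \<phi>_zero: "\<phi> 0 = 0" for v w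
    by (simp_all add: \<phi>_def)
  have "derivation \<phi> (1 - gpow (at_block n (Some s) v)) = 0" for s v
    using i by (simp add: derivation_one_minus_gpow[of \<phi>, OF \<phi>_zero] \<phi>_def)
  then have "derivation \<phi> (block_core n M r s) = 0" for s
    unfolding block_core_def derivation_mult[of \<phi>, OF \<phi>_add]
    by (simp add: derivation_prod_eq_0[of \<phi>, OF \<phi>_add \<phi>_zero])
  then have "derivation \<phi> (\<Prod>s\<in>UNIV \<times> {..<n}. block_core n M r s) = 0"
    by (rule derivation_prod_eq_0[of \<phi>, OF \<phi>_add \<phi>_zero])
  moreover have "\<phi> (link n M r (True, r)) \<noteq> 0"
    using i r M by (simp add: \<phi>_def link_def signed_row_def)
  ultimately show ?thesis
    using square_off_vanishing_product[of \<phi>, OF \<phi>_add _ _ _ _ block_core_link_product_eq_0[OF M(1) r zero], of "(True, r)"] r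
    by simp
qed

text \<open>
  The link of \<open>a\<^sub>r\<close> is \<open>a\<^sub>r + u\<close> with \<open>u\<close> a copy of \<open>a\<^sub>r\<close>, and the essential
  vector \<open>x\<close> is orthogonal to both summands. In the basis of colour \<open>True\<close>,
  \<open>u\<close> is replaced by a unit vector; in that of colour \<open>False\<close>, a unit vector is added to the
  base component. Either change moves the vector off the hyperplane orthogonal to \<open>x\<close>.
\<close>

definition twisted_u :: "nat \<Rightarrow> 'a :: comm_ring_1 mat \<Rightarrow> nat \<Rightarrow> bool \<times> nat \<Rightarrow> 'a vec" where
  "twisted_u n M r s = (if s = (True, r) then unit_vec n r else row M r)"

definition twisted_t :: "nat \<Rightarrow> 'a :: comm_ring_1 mat \<Rightarrow> nat \<Rightarrow> bool \<times> nat \<Rightarrow> 'a vec" where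
  "twisted_t n M r s = signed_row n M s + (if s = (True, r) then unit_vec n r else 0\<^sub>v n)"

lemma glued_product_eq_0:
  fixes M :: "'a :: {field, finite} mat"
  assumes M: "M \<in> carrier_mat n n" "det M \<noteq> 0" and r: "r < n"
    and zero: "AJT_product n M = \<zero>\<^bsub>group_ring TYPE(int) n\<^esub>"
  defines "b \<equiv> glued_family n M r (twisted_u n M r) (twisted_t n M r)"
  shows "(\<Prod>q\<in>slots n. 1 - gpow (b False q)) * (\<Prod>q\<in>slots n. 1 - gpow (b True q)) = (0 :: _ \<Rightarrow>\<^sub>0 'a)"
proof -
  let ?S = "UNIV \<times> {..<n} :: (bool \<times> nat) set" and ?m = "(True, r)"
  let ?E = "\<lambda>s. \<Prod>j<n. 1 - gpow (at_block n (Some s) (unit_vec n j)) :: (block \<times> nat \<Rightarrow> 'a) \<Rightarrow>\<^sub>0 'a"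
  let ?A = "\<lambda>s. \<Prod>j\<in>{..<n} - {r}. 1 - gpow (at_block n (Some s) (row M j)) :: (block \<times> nat \<Rightarrow> 'a) \<Rightarrow>\<^sub>0 'a"
  let ?Y = "\<lambda>s. 1 - gpow (at_block n None (signed_row n M s) + at_block n (Some s) (twisted_u n M r s))
    :: (block \<times> nat \<Rightarrow> 'a) \<Rightarrow>\<^sub>0 'a"
  let ?Z = "\<lambda>s. 1 - gpow (at_block n None (twisted_t n M r s) + at_block n (Some s) (row M r))
    :: (block \<times> nat \<Rightarrow> 'a) \<Rightarrow>\<^sub>0 'a"
  let ?L = "\<lambda>s. 1 - gpow (link n M r s) :: (block \<times> nat \<Rightarrow> 'a) \<Rightarrow>\<^sub>0 'a"
  have "(\<Prod>q\<in>slots n. 1 - gpow (b \<sigma> q))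
      = (\<Prod>k<n. ?Y (\<sigma>, k)) * ((\<Prod>k<n. ?E (\<sigma>, k)) * (\<Prod>k<n. ?Z (\<not> \<sigma>, k) * ?A (\<not> \<sigma>, k)))" for \<sigma>
  proof -
    have "(\<Prod>j<n. 1 - gpow (b \<sigma> (Some (\<not> \<sigma>, k), j))) = ?Z (\<not> \<sigma>, k) * ?A (\<not> \<sigma>, k)" for k
      using r by (simp add: prod.remove[of "{..<n}" r] b_def glued_family_def)
    then show ?thesis
      by (simp add: prod.slots_split[where \<sigma> = \<sigma>]) (simp add: b_def glued_family_def)
  qed
  then have "(\<Prod>q\<in>slots n. 1 - gpow (b False q)) * (\<Prod>q\<in>slots n. 1 - gpow (b True q))
      = (\<Prod>s\<in>?S. block_core n M r s) * (\<Prod>s\<in>?S. ?Y s * ?Z s)"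
    by (simp add: prod.signed_index_split[where \<sigma> = False] block_core_def prod.distrib mult_ac)
  also have "(\<Prod>s\<in>?S. ?Y s * ?Z s) = ?Y ?m * ?Z ?m * (\<Prod>s\<in>?S - {?m}. ?Y s * ?Z s)"
    using r by (intro prod.remove) auto
  \<comment> \<open>Away from the perturbed index, both copies are the true link.\<close>
  also have "(\<Prod>s\<in>?S - {?m}. ?Y s * ?Z s) = (\<Prod>s\<in>?S - {?m}. ?L s * ?L s)"
  proof (intro prod.cong refl)
    fix s assume "s \<in> ?S - {?m}"
    moreover from this have "signed_row n M s \<in> carrier_vec n"
      using M by (auto simp: signed_row_def split: prod.splits)
    ultimately show "?Y s * ?Z s = ?L s * ?L s"
      by (auto simp: twisted_u_def twisted_t_def link_def)
  qed
  also have "\<dots> = (\<Prod>s\<in>?S - {?m}. ?L s)\<^sup>2"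
    by (simp add: prod.distrib power2_eq_square)
  also have "(\<Prod>s\<in>?S. block_core n M r s) * (?Y ?m * ?Z ?m * (\<Prod>s\<in>?S - {?m}. ?L s)\<^sup>2)
      = ?Y ?m * ?Z ?m * ((\<Prod>s\<in>?S. block_core n M r s) * (\<Prod>s\<in>?S - {?m}. ?L s)\<^sup>2)"
    by (simp only: mult_ac)
  also have "\<dots> = 0"
    by (simp add: block_core_link_square_eq_0[OF M r zero])
  finally show ?thesis .
qed

text \<open>
  On every block take the functional given by \<open>x\<close>. It does not vanish on unit vectors nor on rows
  other than \<open>r\<close>. On a link only the base vector contributes, as row \<open>r\<close> gives zero; this is
  nonzero unless the base vector is itself row \<open>r\<close>, and there the perturbation contributes an
  entry of \<open>x\<close>.
\<close>

lemma glued_family_pairing_nonzero: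
  fixes M :: "'a :: field mat"
  assumes M: "M \<in> carrier_mat n n" and r: "r < n" and x: "x \<in> carrier_vec n"
    and nz: "\<forall>i<n. x $ i \<noteq> 0" and ess: "\<forall>i<n. (M *\<^sub>v x) $ i = 0 \<longleftrightarrow> i = r"
    and q: "q \<in> slots n"
  shows "(\<Sum>q'\<in>slots n. glued_family n M r (twisted_u n M r) (twisted_t n M r) \<sigma> q q' * x $ snd q') \<noteq> 0"
proof -
  have row: "row M i \<bullet> x = 0 \<longleftrightarrow> i = r" if "i < n" for i using ess that M by auto
  have unit: "unit_vec n i \<bullet> x = x $ i" if "i < n" for i using that x by simp
  have carrier: "row M i \<in> carrier_vec n" if "i < n" for i using that M by auto
  have pair: "(\<Sum>q'\<in>slots n. at_block n s v q' * x $ snd q') = v \<bullet> x" if "s \<in> blocks n" for s v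
    using that x by (rule at_block_pairing)
  have pair_add: "(\<Sum>q'\<in>slots n. (at_block n s v q' + at_block n s' v' q') * x $ snd q') = v \<bullet> x + v' \<bullet> x"
    if "s \<in> blocks n" "s' \<in> blocks n" for s s' v v'
    using that by (simp add: distrib_right sum.distrib pair)
  obtain s j where sj: "q = (s, j)" "s \<in> blocks n" "j < n" using q by (auto simp: slots_def)
  show ?thesis
  proof (cases s)
    case None
    have "Some (\<sigma>, j) \<in> blocks n" "None \<in> blocks n" using sj by (auto simp: blocks_def)
    then show ?thesis
      using sj nz row[OF r] row[of j] unit
      by (auto simp: None glued_family_def pair_add signed_row_def twisted_u_def)
  next
    case (Some s')
    then obtain \<tau> k where s': "s' = (\<tau>, k)" "k < n" using sj by (auto simp: blocks_def)
    have blocks: "Some s' \<in> blocks n" "None \<in> blocks n" using Some sj by (auto simp: blocks_def)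
    have "signed_row n M s' \<in> carrier_vec n" using s' carrier by (auto simp: signed_row_def)
    then have "twisted_t n M r s' \<bullet> x = signed_row n M s' \<bullet> x + (if s' = (True, r) then x $ r else 0)"
      using x r unit by (simp add: twisted_t_def add_scalar_prod_distrib[of _ n])
    moreover have "signed_row n M s' \<bullet> x = (if \<tau> then row M k \<bullet> x else x $ k)"
      using s' unit by (simp add: signed_row_def)
    ultimately have "twisted_t n M r s' \<bullet> x \<noteq> 0"
      using s' row[OF s'(2)] row[OF r] nz r by auto
    then show ?thesis
      using sj(1,3) s' blocks nz row[OF r] row[of j] unit[of j]
      by (auto simp: Some glued_family_def pair pair_add)
  qed
qed

section \<open>Conjecture A implies the Alon-Jaeger-Tarsi conjecture\<close>

theorem theorem1:
  assumes "CARD('p :: prime_card) > 3"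
    and conjecture_A:
      "\<forall>n\<ge>1. \<forall>M :: 'p mod_ring mat. M \<in> carrier_mat n n \<and> invertible_mat M \<longrightarrow>
         AJT_product n M = \<zero>\<^bsub>group_ring TYPE('p mod_ring) n\<^esub> \<longrightarrow>
         AJT_product n M = \<zero>\<^bsub>group_ring TYPE(int) n\<^esub>"
  shows "\<forall>n\<ge>1. \<forall>M :: 'p mod_ring mat. M \<in> carrier_mat n n \<and> invertible_mat M \<longrightarrow>
     (\<exists>x \<in> carrier_vec n. (\<forall>i<n. x $ i \<noteq> 0) \<and> (\<forall>i<n. (M *\<^sub>v x) $ i \<noteq> 0))"
proof (intro allI impI, rule ccontr)
  fix n and M0 :: "'p mod_ring mat"
  assume M0: "M0 \<in> carrier_mat n n \<and> invertible_mat M0"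
    and bad: "\<not> (\<exists>x\<in>carrier_vec n. (\<forall>i<n. x $ i \<noteq> 0) \<and> (\<forall>i<n. (M0 *\<^sub>v x) $ i \<noteq> 0))"
  have fails0: "AJT_fails n M0"
    using bad unfolding AJT_fails_def by blast
  have "det M0 \<noteq> 0"
    using det_nonzero_iff_invertible_mat[of M0 n] M0 by simp
  from exists_essential_row[OF conjunct1[OF M0] this fails0] obtain M :: "'p mod_ring mat" and r x where M: "M \<in> carrier_mat n n" "det M \<noteq> 0" and fails: "AJT_fails n M"
    and r: "r < n" and x: "x \<in> carrier_vec n" "\<forall>i<n. x $ i \<noteq> 0"
      "\<forall>i<n. (M *\<^sub>v x) $ i = 0 \<longleftrightarrow> i = r"
    by blast
  have zero: "AJT_product n M = \<zero>\<^bsub>group_ring TYPE(int) n\<^esub>"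
    using fails unfolding AJT_fails_def AJT_product_int_eq_zero_iff[OF M(1)] .
  let ?b = "glued_family n M r (twisted_u n M r) (twisted_t n M r)"
  have "slots n \<noteq> {}" using r by (auto simp: slots_def blocks_def)
  then have "\<exists>q\<in>slots n. (\<Sum>q'\<in>slots n. ?b False q q' * x $ snd q') = 0
      \<or> (\<Sum>q'\<in>slots n. ?b True q q' * x $ snd q') = 0"
    by (rule conjecture_A_for_families[OF conjecture_A finite_slots _ glued_family_basis[OF M]
      glued_family_basis[OF M] glued_product_eq_0[OF M r zero]])
  then show False
    using glued_family_pairing_nonzero[OF M(1) r x] by blast
qed

end
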